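(* Let $\mathcal{A}=\{0,1\}$ and $X=\mathcal{A}^{\mathbb{Z}}$. Let $F:\mathfrak{M}_\sigma(X)\to\mathfrak{M}_\sigma(X)$ be a (probabilistic) cellular automaton, let $\mu\in\mathfrak{M}_\sigma(X)$ be a shift-invariant probability measure, and for positive integers $k,n$ let $\nu_n^{(k)}=\left(\Psi^{(k)}F\Psi^{(k)}\right)^n\mu$ be the minimal entropy approximation of order $k$ of $F^n\mu$. Then for any positive integer $n$, $\nu_n^{(k)}$ converges weakly to $F^n\mu$ as $k\to\infty$.
   Context: $\mathfrak{M}_\sigma(X)$ is the set of shift-invariant probability measures on the $\sigma$-algebra generated by cylinder sets of $X=\{0,1\}^{\mathbb{Z}}$ (with the product topology). A block of length $m\ge1$ is a word $\mathbf{b}=b_1\ldots b_m$ over $\mathcal{A}=\{0,1\}$, $|\mathbf{b}|=m$ is its length, $\mathcal{A}^m$ is the set of blocks of length $m$, and $\mathcal{A}^\star$ is the set of all blocks. The cylinder set of $\mathbf{b}$ anchored at $i$ is $[\mathbf{b}]_i=\{\mathbf{x}\in X: x_i\ldots x_{i+m-1}=\mathbf{b}\}$. Cellular automaton. Let $r\ge 0$ be an integer (the radius) and let $w:\mathcal{A}\times\mathcal{A}^{2r+1}\to[0,1]$, with values denoted $w(a|\mathbf{b})$, satisfy $\sum_{a\in\mathcal{A}}w(a|\mathbf{b})=1$ for all $\mathbf{b}\in\mathcal{A}^{2r+1}$. For $\mathbf{b}\in\mathcal{A}^m$ and $\mathbf{a}\in\mathcal{A}^{m+2r}$ put $w(\mathbf{b}|\mathbf{a})=\prod_{j=1}^{m}w(b_j|a_ja_{j+1}\ldots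 a_{j+2r})$. The (probabilistic) cellular automaton of radius $r$ with local transition function $w$ is the map $F:\mathfrak{M}_\sigma(X)\to\mathfrak{M}_\sigma(X)$ given by $$(F\mu)([\mathbf{b}]_i)=\sum_{\mathbf{a}\in\mathcal{A}^{|\mathbf{b}|+2r}}w(\mathbf{b}|\mathbf{a})\,\mu([\mathbf{a}]_{i-r})\quad\text{for all } i\in\mathbb{Z},\ \mathbf{b}\in\mathcal{A}^\star.$$ It is deterministic if $w$ takes values in $\{0,1\}$. Minimal entropy approximation. Define $$\Upsilon(\alpha,\beta,\delta)=\begin{cases}\max\{0,\alpha-\delta\}&\text{if }|\delta-\alpha|<|\beta-\alpha|,\\ \min\{\alpha,\beta\}&\text{otherwise,}\end{cases}$$ and $\Upsilon_{0,0}=\Upsilon$, $\Upsilon_{0,1}=\alpha-\Upsilon$, $\Upsilon_{1,0}=\beta-\Upsilon$, $\Upsilon_{1,1}=\delta-\alpha+\Upsilon$ (all functions of $(\alpha,\beta,\delta)$). For $\mu\in\mathfrak{M}_\sigma(X)$ with block probabilities $P(\mathbf{b})=\mu([\mathbf{b}]_i)$ (independent of $i$) and an integer $k\ge1$, define $\widehat{P}$ on $\mathcal{A}^\star$ recursively by $\widehat{P}(a_1\ldots a_p)=P(a_1\ldots a_p)$ if $p\le k$, and $$\widehat{P}(a_1\ldots a_p)=\Upsilon_{a_1,a_p}\bigl(\widehat{P}(0a_2\ldots a_{p-1}),\widehat{P}(a_2\ldots a_{p-1}0),\widehat{P}(a_2\ldots a_{p-1}1)\bigr)\quad\text{if }p>k.$$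 There is a unique measure $\widehat{\mu}^{(k)}\in\mathfrak{M}_\sigma(X)$ with $\widehat{\mu}^{(k)}([\mathbf{b}]_i)=\widehat{P}(\mathbf{b})$ for all $\mathbf{b}\in\mathcal{A}^\star$, $i\in\mathbb{Z}$. The entropy minimizing operator of order $k$ is $\Psi^{(k)}\mu=\widehat{\mu}^{(k)}$. *)

theory Defs
  imports "HOL-Probability.Probability"
begin

text \<open>
  The alphabet \<open>{0,1}\<close> is \<^typ>\<open>bool\<close>, with \<open>0 = False\<close> and \<open>1 = True\<close>; its type class topology
  is discrete, so the topology of \<^typ>\<open>int \<Rightarrow> bool\<close> is the product topology.  Blocks are
  nonempty lists, indexed from 0 rather than from 1.
\<close>

type_synonym config = "int \<Rightarrow> bool"
type_synonym block = "bool list"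

definition cylinder :: "int \<Rightarrow> block \<Rightarrow> config set" where
  "cylinder i b = {x. \<forall>j<length b. x (i + int j) = b ! j}"

definition cylinder_algebra :: "config measure" where
  "cylinder_algebra = sigma UNIV {cylinder i b | i b. b \<noteq> []}"

definition shift :: "config \<Rightarrow> config" where
  "shift x = (\<lambda>i. x (i + 1))"

definition shift_inv_measures :: "config measure set" where
  "shift_inv_measures =
     {\<mu>. sets \<mu> = sets cylinder_algebra \<and> prob_space \<mu> \<and> distr \<mu> \<mu> shift = \<mu>}"


definition local_transition :: "nat \<Rightarrow> (bool \<Rightarrow> block \<Rightarrow> real) \<Rightarrow> bool" where
  "local_transition r w \<longleftrightarrow>
     (\<forall>b. length b = 2 * r + 1 \<longrightarrow> (\<forall>a. w a b \<in> {0..1}) \<and> (\<Sum>a\<in>UNIV. w a b) = 1)"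

definition block_transition :: "nat \<Rightarrow> (bool \<Rightarrow> block \<Rightarrow> real) \<Rightarrow> block \<Rightarrow> block \<Rightarrow> real" where
  "block_transition r w b a = (\<Prod>j<length b. w (b ! j) (take (2 * r + 1) (drop j a)))"

text \<open>A measure on the cylinder algebra is determined by its values on cylinders, so the
  definite descriptions below single out at most one measure.\<close>

definition cellular_automaton ::
  "nat \<Rightarrow> (bool \<Rightarrow> block \<Rightarrow> real) \<Rightarrow> config measure \<Rightarrow> config measure" where
  "cellular_automaton r w \<mu> =
     (THE \<nu>. \<nu> \<in> shift_inv_measures \<and>
        (\<forall>i b. b \<noteq> [] \<longrightarrow>
           measure \<nu> (cylinder i b) =
             (\<Sum>a | length a = length b + 2 * r.
                block_transition r w b a * measure \<mu> (cylinder (i - int r) a))))"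


definition Upsilon :: "real \<Rightarrow> real \<Rightarrow> real \<Rightarrow> real" where
  "Upsilon \<alpha> \<beta> \<delta> = (if \<bar>\<delta> - \<alpha>\<bar> < \<bar>\<beta> - \<alpha>\<bar> then max 0 (\<alpha> - \<delta>) else min \<alpha> \<beta>)"

fun Upsilon_ext :: "bool \<Rightarrow> bool \<Rightarrow> real \<Rightarrow> real \<Rightarrow> real \<Rightarrow> real" where
  "Upsilon_ext False False \<alpha> \<beta> \<delta> = Upsilon \<alpha> \<beta> \<delta>"
| "Upsilon_ext False True \<alpha> \<beta> \<delta> = \<alpha> - Upsilon \<alpha> \<beta> \<delta>"
| "Upsilon_ext True False \<alpha> \<beta> \<delta> = \<beta> - Upsilon \<alpha> \<beta> \<delta>"
| "Upsilon_ext True True \<alpha> \<beta> \<delta> = \<delta> - \<alpha> + Upsilon \<alpha> \<beta> \<delta>"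

text \<open>The guard \<open>length a < 2\<close> is implied by \<open>length a \<le> k\<close> when \<open>k \<ge> 1\<close> and \<open>a\<close> is a block; it
  only serves termination at \<open>k = 0\<close>.  The list \<open>butlast (tl a)\<close> is the interior
  \<open>a\<^sub>2\<dots>a\<^sub>p\<^sub>-\<^sub>1\<close>, empty for \<open>p = 2\<close>.\<close>

function min_entropy_prob :: "nat \<Rightarrow> (block \<Rightarrow> real) \<Rightarrow> block \<Rightarrow> real" where
  "min_entropy_prob k P a =
     (if length a \<le> k \<or> length a < 2 then P a
      else Upsilon_ext (hd a) (last a)
             (min_entropy_prob k P (False # butlast (tl a)))
             (min_entropy_prob k P (butlast (tl a) @ [False]))
             (min_entropy_prob k P (butlast (tl a) @ [True])))"
  by pat_completeness auto
termination
  by (relation "Wellfounded.measure (\<lambda>(k, P, a). length a)") auto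

declare min_entropy_prob.simps [simp del]

definition entropy_min_operator :: "nat \<Rightarrow> config measure \<Rightarrow> config measure" where
  "entropy_min_operator k \<mu> =
     (THE \<nu>. \<nu> \<in> shift_inv_measures \<and>
        (\<forall>i b. b \<noteq> [] \<longrightarrow>
           measure \<nu> (cylinder i b) =
             min_entropy_prob k (\<lambda>c. measure \<mu> (cylinder 0 c)) b))"


definition weakly_converges ::
  "(nat \<Rightarrow> 'a::topological_space measure) \<Rightarrow> 'a measure \<Rightarrow> bool" where
  "weakly_converges M_seq M \<longleftrightarrow>
     (\<forall>f :: 'a \<Rightarrow> real. continuous_on UNIV f \<and> bounded (range f) \<longrightarrow>
        (\<lambda>k. integral\<^sup>L (M_seq k) f) \<longlonglongrightarrow> integral\<^sup>L M f)"

end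

theory Submission
  imports Defs
begin

text \<open>
  The order-\<open>k\<close> approximation does not change the probabilities of blocks of length at most \<open>k\<close>,
  and the \<open>F\<close>-image probability of a block of length \<open>m\<close> only depends on the probabilities of
  blocks of length \<open>m + 2r\<close>.  Hence \<open>\<nu>\<^sub>n\<close> of order \<open>k\<close> and \<open>F\<^sup>n\<mu>\<close> give the same probability to
  every block of length at most \<open>k - 2rn\<close>.  Since a continuous function on the compact space of
  configurations is uniformly approximated by functions of finitely many coordinates, weak
  convergence follows.  That \<open>F\<close> and the entropy minimizing operators are well defined is a
  Kolmogorov extension argument: consistent block probabilities define a premeasure on the
  algebra of clopen sets, and its continuity at the empty set is again compactness.
\<close>

section \<open>Windows\<close>

definition window :: "nat \<Rightarrow> config \<Rightarrow> block" where
  "window N x = map (\<lambda>j. x (int j - int N)) [0..<2 * N + 1]"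

text \<open>Serves as a right inverse of \<open>window N\<close> on lists of length 2N+1. Outside
  [-N, N] the values are defaults: the first letter to the left, an out-of-range \<open>!\<close> to
  the right.\<close>

definition unwindow :: "nat \<Rightarrow> block \<Rightarrow> config" where
  "unwindow N b = (\<lambda>i. b ! nat (i + int N))"

text \<open>The algebra of events determined by finitely many coordinates. Words of the wrong length
  in \<open>S\<close> do no harm, since \<open>window N\<close> never takes them as values.\<close>

definition window_sets :: "config set set" where
  "window_sets = {window N -` S | N S. True}"

lemma length_window [simp]: "length (window N x) = 2 * N + 1"
  by (simp add: window_def)

lemma window_eq_iff: "window N x = window N y \<longleftrightarrow> (\<forall>i. \<bar>i\<bar> \<le> int N \<longrightarrow> x i = y i)"
proof
  assume eq: "window N x = window N y"
  show "\<forall>i. \<bar>i\<bar> \<le> int N \<longrightarrow> x i = y i"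
  proof (intro allI impI)
    fix i :: int assume i: "\<bar>i\<bar> \<le> int N"
    then have "nat (i + int N) < 2 * N + 1" by linarith
    then have "nat (i + int N) \<in> set [0..<2 * N + 1]" by (simp del: upt_Suc)
    with eq have "x (int (nat (i + int N)) - int N) = y (int (nat (i + int N)) - int N)"
      unfolding window_def map_eq_conv by blast
    moreover have "int (nat (i + int N)) - int N = i" using i by linarith
    ultimately show "x i = y i" by simp
  qed
next
  assume "\<forall>i. \<bar>i\<bar> \<le> int N \<longrightarrow> x i = y i"
  then show "window N x = window N y"
    by (auto simp: window_def simp del: upt_Suc)
qed

lemma window_eq_mono: "window M x = window M y \<Longrightarrow> N \<le> M \<Longrightarrow> window N x = window N y"
  unfolding window_eq_iff by force

lemma window_unwindow: "length b = 2 * N + 1 \<Longrightarrow> window N (unwindow N b) = b"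
  by (rule nth_equalityI) (auto simp: window_def unwindow_def simp del: upt_Suc)

lemma window_vimage_singleton:
  "length b = 2 * N + 1 \<Longrightarrow> window N -` {b} = cylinder (- int N) b"
  by (auto simp: window_def cylinder_def list_eq_iff_nth_eq simp del: upt_Suc)

lemma window_vimage_eq_Union:
  "window N -` S = (\<Union>b \<in> {b \<in> S. length b = 2 * N + 1}. cylinder (- int N) b)"
  by (auto simp: window_vimage_singleton[symmetric])

lemma window_vimage_mono:
  assumes "N \<le> M"
  shows "\<exists>T. window N -` S = window M -` T"
proof
  show "window N -` S = window M -` (window M ` (window N -` S))"
  proof (intro equalityI subsetI)
    fix x assume "x \<in> window M -` (window M ` (window N -` S))"
    then obtain y where "window M x = window M y" "window N y \<in> S" by auto
    moreover from this(1) have "window N x = window N y" using assms by (rule window_eq_mono)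
    ultimately show "x \<in> window N -` S" by simp
  qed auto
qed

text \<open>A common radius turns unions, intersections and differences of window sets into the same
  operations on sets of words.\<close>

lemma window_setsE2:
  assumes "A \<in> window_sets" "B \<in> window_sets"
  obtains N S T where "A = window N -` S" "B = window N -` T"
proof -
  obtain M S K T where A: "A = window M -` S" and B: "B = window K -` T"
    using assms by (auto simp: window_sets_def)
  obtain S' where "A = window (max M K) -` S'"
    using window_vimage_mono[of M "max M K" S] A by auto
  moreover obtain T' where "B = window (max M K) -` T'"
    using window_vimage_mono[of K "max M K" T] B by auto
  ultimately show ?thesis using that by blast
qed

lemma finite_blocks: "finite {b :: block. length b = m}"
  using finite_lists_length_eq[of "UNIV :: bool set" m] by simp

lemma finite_blocks_in [simp]: "finite {b :: block. P b \<and> length b = m}"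
  by (rule finite_subset[OF _ finite_blocks[of m]]) auto

lemma cylinder_in_window_sets: "cylinder i b \<in> window_sets"
proof -
  \<comment> \<open>Large enough that all positions read by the cylinder lie in [-N, N].\<close>
  define N where "N = nat \<bar>i\<bar> + length b"
  have "cylinder i b = window N -` (window N ` cylinder i b)"
  proof (intro equalityI subsetI)
    fix x assume "x \<in> window N -` (window N ` cylinder i b)"
    then obtain y where y: "window N x = window N y" "y \<in> cylinder i b" by auto
    have "x (i + int j) = y (i + int j)" if "j < length b" for j
      using y(1) that unfolding window_eq_iff by (auto simp: N_def)
    then show "x \<in> cylinder i b" using y(2) by (simp add: cylinder_def)
  qed auto
  then show ?thesis unfolding window_sets_def by blast
qed

section \<open>Topology of the configuration space\<close>

lemma open_cylinder: "open (cylinder i b)"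
proof -
  have "cylinder i b = (\<Inter>j<length b. (\<lambda>x. x (i + int j)) -` {b ! j})"
    by (auto simp: cylinder_def)
  moreover have "open ((\<lambda>x :: config. x (i + int j)) -` {b ! j})" for j
    by (rule open_vimage[OF Topological_Spaces.open_discrete continuous_on_product_coordinates])
  ultimately show ?thesis
    by (simp add: open_INT)
qed

lemma open_window_vimage: "open (window N -` S)"
  unfolding window_vimage_eq_Union by (intro open_UN ballI open_cylinder)

lemma closed_window_vimage: "closed (window N -` S)"
  unfolding closed_def vimage_Compl[symmetric] by (rule open_window_vimage)

lemma compact_UNIV_config: "compact (UNIV :: config set)"
proof -
  have "compact_space (product_topology (\<lambda>_. euclidean :: bool topology) (UNIV :: int set))"
    unfolding compact_space_product_topology
    by (simp add: compact_space_def finite_imp_compact)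
  then show ?thesis
    by (simp add: euclidean_product_topology compact_space_def)
qed

lemma open_contains_window:
  fixes U :: "config set"
  assumes "open U" "x \<in> U"
  shows "\<exists>N. window N -` {window N x} \<subseteq> U"
proof -
  have "openin (product_topology (\<lambda>_. euclidean) UNIV) U"
    using assms(1) by (simp add: euclidean_product_topology)
  from product_topology_open_contains_basis[OF this assms(2)]
  obtain X where X: "x \<in> (\<Pi>\<^sub>E i\<in>UNIV. X i)" "finite {i. X i \<noteq> UNIV}" "(\<Pi>\<^sub>E i\<in>UNIV. X i) \<subseteq> U"
    by auto
  \<comment> \<open>A basic open set constrains finitely many coordinates; N bounds their absolute
    values.\<close>
  obtain N where N: "\<And>i. X i \<noteq> UNIV \<Longrightarrow> nat \<bar>i\<bar> \<le> N"
    using finite_nat_set_iff_bounded_le[of "(\<lambda>i. nat \<bar>i\<bar>) ` {i. X i \<noteq> UNIV}"] X(2) by auto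
  have "window N -` {window N x} \<subseteq> (\<Pi>\<^sub>E i\<in>UNIV. X i)"
  proof
    fix y assume "y \<in> window N -` {window N x}"
    then have y: "y i = x i" if "\<bar>i\<bar> \<le> int N" for i
      using that by (simp add: window_eq_iff)
    have "y i \<in> X i" for i
    proof (cases "X i = UNIV")
      case False
      then have "y i = x i" using N y by force
      then show ?thesis using X(1) by (auto simp: PiE_iff)
    qed simp
    then show "y \<in> (\<Pi>\<^sub>E i\<in>UNIV. X i)" by (simp add: PiE_iff)
  qed
  then show ?thesis using X(3) by blast
qed

text \<open>Uniform continuity by compactness: around each point f varies by less than e/2 on some
  window neighbourhood, and the largest radius in a finite subcover works everywhere.\<close>

lemma continuous_uniform_window:
  fixes f :: "config \<Rightarrow> real"
  assumes f: "continuous_on UNIV f" and "e > 0"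
  shows "\<exists>N. \<forall>x y. window N x = window N y \<longrightarrow> \<bar>f x - f y\<bar> < e"
proof -
  have "\<exists>N. \<forall>y. window N y = window N x \<longrightarrow> \<bar>f y - f x\<bar> < e / 2" for x
  proof -
    have "open (f -` ball (f x) (e / 2))"
      using f by (intro open_vimage open_ball)
    from open_contains_window[OF this, of x] \<open>e > 0\<close> show ?thesis
      by (auto simp: subset_iff dist_real_def abs_minus_commute)
  qed
  then obtain n where n: "\<And>x y. window (n x) y = window (n x) x \<Longrightarrow> \<bar>f y - f x\<bar> < e / 2"
    by metis
  obtain C where C: "finite C" "UNIV \<subseteq> (\<Union>x\<in>C. window (n x) -` {window (n x) x})"
    by (rule compactE_image[OF compact_UNIV_config, of UNIV
          "\<lambda>x. window (n x) -` {window (n x) x}"])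
       (auto intro: open_window_vimage)
  obtain N where N: "\<And>x. x \<in> C \<Longrightarrow> n x \<le> N"
    using finite_nat_set_iff_bounded_le[of "n ` C"] C(1) by auto
  have "\<bar>f x - f y\<bar> < e" if xy: "window N x = window N y" for x y
  proof -
    obtain z where z: "z \<in> C" "window (n z) x = window (n z) z"
      using C(2) by auto
    have "window (n z) y = window (n z) x"
      using xy N[OF z(1)] by (metis window_eq_mono)
    then have "\<bar>f x - f z\<bar> < e / 2" "\<bar>f y - f z\<bar> < e / 2"
      using n z(2) by auto
    then show ?thesis by linarith
  qed
  then show ?thesis by blast
qed

section \<open>Measures on the cylinder algebra\<close>

lemma sets_cylinder_algebra:
  "sets cylinder_algebra = sigma_sets UNIV {cylinder i b | i b. b \<noteq> []}"
  unfolding cylinder_algebra_def by (rule sets_measure_of) auto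

lemma space_cylinder_algebra [simp]: "space cylinder_algebra = UNIV"
  unfolding cylinder_algebra_def by (rule space_measure_of) auto

lemma cylinder_Nil [simp]: "cylinder i [] = UNIV"
  by (simp add: cylinder_def)

lemma cylinder_sets [measurable]: "cylinder i b \<in> sets cylinder_algebra"
proof (cases "b = []")
  case True
  then show ?thesis using sets.top[of cylinder_algebra] by simp
next
  case False
  then show ?thesis unfolding sets_cylinder_algebra by (intro sigma_sets.Basic) blast
qed

lemma window_vimage_sets: "window N -` S \<in> sets cylinder_algebra"
  unfolding window_vimage_eq_Union by (intro sets.finite_UN cylinder_sets) auto

text \<open>Cylinders are not closed under intersection (blocks may conflict or leave a gap),
  whereas window sets are, so the latter serve as the generating pi-system.\<close>

lemma sets_cylinder_algebra_window: "sets cylinder_algebra = sigma_sets UNIV window_sets"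
proof (rule antisym)
  show "sets cylinder_algebra \<subseteq> sigma_sets UNIV window_sets"
    unfolding sets_cylinder_algebra
    by (intro sigma_sets_mono) (auto intro: cylinder_in_window_sets)
  show "sigma_sets UNIV window_sets \<subseteq> sets cylinder_algebra"
    using sets.sigma_sets_subset[of window_sets cylinder_algebra] window_vimage_sets
    by (auto simp: window_sets_def)
qed

section \<open>Additivity over cylinders and uniqueness of measures\<close>

lemma disjoint_cylinders:
  "length b = length c \<Longrightarrow> b \<noteq> c \<Longrightarrow> cylinder i b \<inter> cylinder i c = {}"
  by (auto simp: cylinder_def list_eq_iff_nth_eq)

lemma measure_window_vimage:
  assumes "prob_space M" and M: "sets M = sets cylinder_algebra"
  shows "measure M (window N -` S) =
    (\<Sum>b | b \<in> S \<and> length b = 2 * N + 1. measure M (cylinder (- int N) b))"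
proof -
  interpret prob_space M by fact
  show ?thesis unfolding window_vimage_eq_Union
    by (rule finite_measure_finite_Union)
       (auto simp: M disjoint_family_on_def disjoint_cylinders)
qed

lemma cylinder_append: "cylinder i b = cylinder i (b @ [False]) \<union> cylinder i (b @ [True])"
  by (auto simp: cylinder_def nth_append less_Suc_eq)

lemma cylinder_Cons: "cylinder i b = cylinder (i - 1) (False # b) \<union> cylinder (i - 1) (True # b)"
  by (auto simp: cylinder_def nth_Cons less_Suc_eq_0_disj algebra_simps)

lemma measure_cylinder_append:
  assumes "prob_space M" and M: "sets M = sets cylinder_algebra"
  shows "measure M (cylinder i b) =
    measure M (cylinder i (b @ [False])) + measure M (cylinder i (b @ [True]))"
proof -
  interpret prob_space M by fact
  show ?thesis
    by (subst cylinder_append, rule finite_measure_Union) (auto simp: M disjoint_cylinders)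
qed

lemma measure_cylinder_Cons:
  assumes "prob_space M" and M: "sets M = sets cylinder_algebra"
  shows "measure M (cylinder i b) =
    measure M (cylinder (i - 1) (False # b)) + measure M (cylinder (i - 1) (True # b))"
proof -
  interpret prob_space M by fact
  show ?thesis
    by (subst cylinder_Cons, rule finite_measure_Union) (auto simp: M disjoint_cylinders)
qed

text \<open>Each window set is a finite disjoint union of cylinders, so the cylinder values fix the
  measure on a generating pi-system.\<close>

lemma cylinder_measure_eqI:
  assumes M: "prob_space M" "sets M = sets cylinder_algebra"
    and N: "prob_space N" "sets N = sets cylinder_algebra"
    and eq: "\<And>i b. b \<noteq> [] \<Longrightarrow> measure M (cylinder i b) = measure N (cylinder i b)"
  shows "M = N"
proof (rule measure_eqI_generator_eq[where E = window_sets and \<Omega> = UNIV and A = "\<lambda>_. UNIV"])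
  interpret M: prob_space M by fact
  interpret N: prob_space N by fact
  show "Int_stable window_sets"
  proof (rule Int_stableI)
    fix A B assume "A \<in> window_sets" "B \<in> window_sets"
    then obtain N S T where "A = window N -` S" "B = window N -` T"
      by (rule window_setsE2)
    then have "A \<inter> B = window N -` (S \<inter> T)" by auto
    then show "A \<inter> B \<in> window_sets" unfolding window_sets_def by blast
  qed
  show "emeasure M X = emeasure N X" if Xw: "X \<in> window_sets" for X
  proof -
    obtain K S where X: "X = window K -` S" by (rule window_setsE2[OF Xw Xw])
    have "measure M X = measure N X"
      unfolding X measure_window_vimage[OF M] measure_window_vimage[OF N]
      by (intro sum.cong refl eq) auto
    then show ?thesis by (simp add: M.emeasure_eq_measure N.emeasure_eq_measure)
  qed
  show "range (\<lambda>_. UNIV) \<subseteq> window_sets"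
    using cylinder_in_window_sets[of 0 "[]"] by auto
qed (use M N in \<open>auto simp: sets_cylinder_algebra_window emeasure_eq_measure2
       finite_measure.emeasure_finite prob_space.finite_measure\<close>)

section \<open>Shift-invariant measures\<close>

lemma shift_vimage_cylinder: "shift -` cylinder i b = cylinder (i + 1) b"
  by (auto simp: shift_def cylinder_def algebra_simps)

lemma measurable_shift [measurable]: "shift \<in> cylinder_algebra \<rightarrow>\<^sub>M cylinder_algebra"
  by (rule measurable_sigma_sets[OF sets_cylinder_algebra])
     (auto simp: shift_vimage_cylinder)

lemma shift_inv_measuresD:
  assumes "\<mu> \<in> shift_inv_measures"
  shows "prob_space \<mu>" "sets \<mu> = sets cylinder_algebra" "distr \<mu> \<mu> shift = \<mu>" "space \<mu> = UNIV"
  using assms sets_eq_imp_space_eq[of \<mu> cylinder_algebra]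
  by (auto simp: shift_inv_measures_def)

lemma measure_cylinder_shift_inv:
  assumes \<mu>: "\<mu> \<in> shift_inv_measures"
  shows "measure \<mu> (cylinder i b) = measure \<mu> (cylinder 0 b)"
proof -
  note \<mu>' = shift_inv_measuresD[OF \<mu>]
  have meas: "shift \<in> \<mu> \<rightarrow>\<^sub>M \<mu>"
    using measurable_shift measurable_cong_sets[OF \<mu>'(2) \<mu>'(2)] by blast
  have step: "measure \<mu> (cylinder (i + 1) b) = measure \<mu> (cylinder i b)" for i
    using measure_distr[OF meas, of "cylinder i b"] \<mu>' by (simp add: shift_vimage_cylinder)
  show ?thesis
  proof (induction i rule: int_induct[where k = 0])
    case (step2 i)
    then show ?case using step[of "i - 1"] by simp
  qed (simp_all add: step)
qed

section \<open>Extension of consistent block probabilities\<close>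

text \<open>Kolmogorov consistency under extension on either side. As \<open>Q\<close> carries no
  anchor, the two-sided form also makes the resulting measure stationary.\<close>

locale consistent_blocks =
  fixes Q :: "block \<Rightarrow> real"
  assumes nonneg: "Q b \<ge> 0"
    and Nil: "Q [] = 1"
    and append: "Q (b @ [False]) + Q (b @ [True]) = Q b"
    and Cons: "Q (False # b) + Q (True # b) = Q b"
begin

text \<open>Has its intended meaning when \<open>A\<close> is determined by the coordinates in
  [-N, N]; otherwise a window of a point of \<open>A\<close> may also occur outside
  \<open>A\<close>.\<close>

definition charge :: "nat \<Rightarrow> config set \<Rightarrow> real" where
  "charge N A = (\<Sum>b \<in> window N ` A. Q b)"

lemma finite_window_image: "finite (window N ` A)"
  by (rule finite_subset[OF _ finite_blocks[of "2 * N + 1"]]) auto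

lemma window_Suc:
  "window (Suc N) x = x (- int N - 1) # window N x @ [x (int N + 1)]"
proof -
  have upt: "[0..<2 * Suc N + 1] = 0 # map Suc [0..<2 * N + 1] @ [2 * N + 2]"
    unfolding map_Suc_upt by (simp add: upt_conv_Cons)
  show ?thesis unfolding window_def upt
    by (auto simp: algebra_simps diff_diff_eq intro!: arg_cong[of _ _ x] simp del: upt_Suc)
qed

text \<open>Raising the radius by one adds a free letter at each end; \<open>append\<close> sums out
  the right one and \<open>Cons\<close> the left one.\<close>

lemma charge_Suc: "charge (Suc N) (window N -` S) = charge N (window N -` S)"
proof -
  let ?W = "window N ` (window N -` S)"
  let ?ext = "\<lambda>(b, c, d). c # b @ [d] :: block"
  have "window (Suc N) ` (window N -` S) = ?ext ` (?W \<times> UNIV \<times> UNIV)" (is "?L = ?R")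
  proof
    show "?L \<subseteq> ?R"
    proof (rule image_subsetI)
      fix x assume "x \<in> window N -` S"
      then show "window (Suc N) x \<in> ?R"
        unfolding window_Suc by (intro image_eqI[of _ _ "(window N x, _, _)"]) auto
    qed
    show "?R \<subseteq> ?L"
    proof safe
      fix x c d assume x: "window N x \<in> S"
      \<comment> \<open>Changing x only at the two new positions keeps its central window, so every
        pair of outer letters occurs.\<close>
      define y where "y = x(- int N - 1 := c, int N + 1 := d)"
      have y: "window N y = window N x" by (auto simp: window_eq_iff y_def)
      then have "window (Suc N) y = c # window N x @ [d]" by (simp add: window_Suc) (simp add: y_def)
      then show "c # window N x @ [d] \<in> ?L" using x y by (metis image_eqI vimage_eq)
    qed
  qed
  then have "charge (Suc N) (window N -` S) = (\<Sum>z \<in> ?W \<times> UNIV \<times> UNIV. Q (?ext z))"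
    unfolding charge_def by (simp only:) (subst sum.reindex, auto simp: inj_on_def)
  also have "\<dots> = (\<Sum>b \<in> ?W. \<Sum>c\<in>UNIV. \<Sum>d\<in>UNIV. Q (c # b @ [d]))"
    by (simp add: sum.cartesian_product case_prod_beta)
  also have "\<dots> = (\<Sum>b \<in> ?W. Q b)"
  proof (rule sum.cong[OF refl])
    fix b
    have "(\<Sum>c\<in>UNIV. \<Sum>d\<in>UNIV. Q (c # b @ [d])) = (\<Sum>c\<in>UNIV. Q (c # b))"
      using append[of "_ # b"] by (intro sum.cong) (auto simp: UNIV_bool add.commute)
    then show "(\<Sum>c\<in>UNIV. \<Sum>d\<in>UNIV. Q (c # b @ [d])) = Q b"
      using Cons[of b] by (simp add: UNIV_bool)
  qed
  finally show ?thesis by (simp add: charge_def)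
qed

text \<open>The least radius is a canonical choice that makes this a function of the set alone;
  \<open>premeasure_eq\<close> shows that every admissible radius gives the same value.\<close>

definition premeasure :: "config set \<Rightarrow> real" where
  "premeasure A = charge (LEAST N. \<exists>S. A = window N -` S) A"

lemma premeasure_eq: "premeasure (window N -` S) = charge N (window N -` S)"
proof -
  define A where "A = window N -` S"
  define M where "M = (LEAST N. \<exists>S. A = window N -` S)"
  have M: "\<exists>T. A = window M -` T" unfolding M_def A_def by (rule LeastI) blast
  have "M \<le> N" unfolding M_def A_def by (rule Least_le) blast
  \<comment> \<open>Climb from the least radius to N: at each radius in between the set is again a
    window preimage, so \<open>charge_Suc\<close> applies.\<close>
  then have "charge N A = charge M A"
  proof (induction rule: dec_induct)
    case (step m)
    obtain T where T: "A = window m -` T"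
      using window_vimage_mono[OF step(1)] M by metis
    show ?case using charge_Suc[of m T, folded T] step.IH by (rule trans)
  qed simp
  then show ?thesis by (simp add: premeasure_def M_def A_def)
qed

lemma premeasure_nonneg: "premeasure A \<ge> 0"
  unfolding premeasure_def charge_def by (intro sum_nonneg nonneg)

lemma premeasure_empty [simp]: "premeasure {} = 0"
  by (simp add: premeasure_def charge_def)

lemma premeasure_Un:
  assumes "A \<in> window_sets" "B \<in> window_sets" "A \<inter> B = {}"
  shows "premeasure (A \<union> B) = premeasure A + premeasure B"
proof -
  obtain N S T where A: "A = window N -` S" and B: "B = window N -` T"
    using assms(1,2) by (rule window_setsE2)
  have AB: "A \<union> B = window N -` (S \<union> T)" using A B by auto
  have "window N ` A \<inter> window N ` B = {}" using assms(3) A B by auto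
  then have "charge N (A \<union> B) = charge N A + charge N B"
    unfolding charge_def image_Un by (intro sum.union_disjoint finite_window_image)
  then show ?thesis
    using premeasure_eq[of N S] premeasure_eq[of N T] premeasure_eq[of N "S \<union> T"] A B AB
    by simp
qed

lemma premeasure_cylinder:
  assumes "length b = 2 * N + 1"
  shows "premeasure (cylinder (- int N) b) = Q b"
proof -
  have "window N ` (window N -` {b}) = {b}"
    using window_unwindow[OF assms] by auto
  then show ?thesis
    using premeasure_eq[of N "{b}"] by (simp add: window_vimage_singleton[OF assms] charge_def)
qed

lemma premeasure_UNIV: "premeasure UNIV = 1"
proof -
  have "UNIV = cylinder 0 [False] \<union> cylinder 0 [True]"
    using cylinder_append[of 0 "[]"] by simp
  then have "premeasure UNIV = premeasure (cylinder 0 [False]) + premeasure (cylinder 0 [True])"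
    using premeasure_Un[of "cylinder 0 [False]" "cylinder 0 [True]"]
    by (simp add: cylinder_in_window_sets disjoint_cylinders)
  then show ?thesis
    using premeasure_cylinder[of "[_]" 0] append[of "[]"] Nil by simp
qed

text \<open>Caratheodory extension, in the form where continuity at the empty set along decreasing
  sequences replaces countable additivity.\<close>

lemma extension_exists:
  "\<exists>\<nu>. prob_space \<nu> \<and> sets \<nu> = sets cylinder_algebra \<and>
     (\<forall>A\<in>window_sets. measure \<nu> A = premeasure A)"
proof -
  interpret ring_of_sets UNIV window_sets
    unfolding ring_of_sets_iff
  proof (intro conjI ballI)
    show "{} \<in> window_sets" unfolding window_sets_def by (auto intro: exI[of _ "{}"])
    fix A B assume "A \<in> window_sets" "B \<in> window_sets"
    then obtain N S T where "A = window N -` S" "B = window N -` T"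
      by (rule window_setsE2)
    then have "A \<union> B = window N -` (S \<union> T)" "A - B = window N -` (S - T)" by auto
    then show "A \<union> B \<in> window_sets" "A - B \<in> window_sets"
      unfolding window_sets_def by blast+
  qed simp
  let ?f = "\<lambda>A. ennreal (premeasure A)"
  have "\<exists>m. (\<forall>A\<in>window_sets. m A = ?f A) \<and> measure_space UNIV (sigma_sets UNIV window_sets) m"
  proof (rule caratheodory_empty_continuous)
    show "positive window_sets ?f" by (simp add: positive_def)
    show "additive window_sets ?f"
      by (simp add: additive_def premeasure_Un premeasure_nonneg)
    fix A :: "nat \<Rightarrow> config set"
    assume A: "range A \<subseteq> window_sets" "decseq A" "(\<Inter>i. A i) = {}"
    \<comment> \<open>Decreasing nonempty closed sets in a compact space have a common point, so an
      empty intersection forces some \<open>A n\<close> to be empty already.\<close>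
    have "\<exists>n. A n = {}"
    proof (rule ccontr)
      assume ne: "\<nexists>n. A n = {}"
      have "UNIV \<inter> (\<Inter>i\<in>UNIV. A i) \<noteq> {}"
      proof (rule compact_imp_fip_image[OF compact_UNIV_config])
        show "closed (A i)" for i
        proof -
          have "A i \<in> window_sets" using A(1) by blast
          from window_setsE2[OF this this] show ?thesis by (metis closed_window_vimage)
        qed
        fix I :: "nat set" assume "finite I"
        then obtain n where n: "\<forall>i\<in>I. i \<le> n"
          unfolding finite_nat_set_iff_bounded_le by (elim exE)
        have "A n \<subseteq> (\<Inter>i\<in>I. A i)"
          by (rule INF_greatest) (rule decseqD[OF A(2)], rule bspec[OF n])
        moreover have "A n \<noteq> {}" using ne by simp
        ultimately show "UNIV \<inter> (\<Inter>i\<in>I. A i) \<noteq> {}" by fast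
      qed
      then show False using A(3) by simp
    qed
    then obtain n where "A n = {}" by blast
    then have "A i = {}" if "i \<ge> n" for i using decseqD[OF A(2) that] by simp
    then have "eventually (\<lambda>i. ?f (A i) = 0) sequentially"
      unfolding eventually_sequentially by (intro exI[of _ n]) simp
    then show "(\<lambda>i. ?f (A i)) \<longlonglongrightarrow> 0" by (rule tendsto_eventually)
  qed simp
  then obtain m where m: "\<And>A. A \<in> window_sets \<Longrightarrow> m A = ?f A"
    and ms: "measure_space UNIV (sigma_sets UNIV window_sets) m" by blast
  define \<nu> where "\<nu> = measure_of UNIV window_sets m"
  have sets: "sets \<nu> = sets cylinder_algebra"
    unfolding \<nu>_def sets_cylinder_algebra_window by (rule sets_measure_of) simp
  have em: "emeasure \<nu> A = ?f A" if "A \<in> window_sets" for A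
  proof -
    have "emeasure \<nu> A = m A"
      using ms that unfolding measure_space_def
      by (intro emeasure_measure_of[OF \<nu>_def]) (auto simp: sets \<nu>_def)
    then show ?thesis using m that by simp
  qed
  have "UNIV \<in> window_sets" using cylinder_in_window_sets[of 0 "[]"] by simp
  then have "prob_space \<nu>"
    using em[of UNIV] by (intro prob_spaceI) (simp add: \<nu>_def space_measure_of premeasure_UNIV)
  moreover have "measure \<nu> A = premeasure A" if "A \<in> window_sets" for A
    using em[OF that] by (simp add: measure_def premeasure_nonneg)
  ultimately show ?thesis using sets by blast
qed

text \<open>\<open>premeasure_cylinder\<close> covers only blocks that fill a whole window; other
  blocks are reached by summing over the missing letters, first on the right and then on the
  left.\<close>

lemma extension_cylinder:
  assumes \<nu>: "prob_space \<nu>" "sets \<nu> = sets cylinder_algebra"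
    and pm: "\<And>A. A \<in> window_sets \<Longrightarrow> measure \<nu> A = premeasure A"
  shows "measure \<nu> (cylinder i b) = Q b"
proof -
  define N where "N = nat \<bar>i\<bar> + length b"
  \<comment> \<open>Downward induction on the length, starting from full windows; each step removes
    a last letter.\<close>
  have left: "measure \<nu> (cylinder (- int N) c) = Q c" if "length c \<le> 2 * N + 1" for c
    using that
  proof (induction "2 * N + 1 - length c" arbitrary: c)
    case 0
    then show ?case
      using pm[OF cylinder_in_window_sets] premeasure_cylinder[of c N] by simp
  next
    case (Suc m)
    then have "measure \<nu> (cylinder (- int N) (c @ [y])) = Q (c @ [y])" for y by auto
    then show ?case
      using measure_cylinder_append[OF \<nu>, of "- int N" c] append[of c] by simp
  qed
  \<comment> \<open>Moving the anchor one place to the right removes a first letter, so m counts the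
    letters dropped on the left.\<close>
  have "measure \<nu> (cylinder (- int N + int m) c) = Q c" if "m + length c \<le> 2 * N + 1" for m c
    using that
  proof (induction m arbitrary: c)
    case 0
    then show ?case using left by simp
  next
    case (Suc m)
    then have "measure \<nu> (cylinder (- int N + int m) (y # c)) = Q (y # c)" for y by simp
    then show ?case
      using measure_cylinder_Cons[OF \<nu>, of "- int N + int (Suc m)" c] Cons[of c]
      by (simp add: algebra_simps)
  qed
  moreover have N: "int N = \<bar>i\<bar> + int (length b)" by (simp add: N_def)
  then have "nat (i + int N) + length b \<le> 2 * N + 1" by arith
  moreover have "- int N + int (nat (i + int N)) = i" using N by arith
  ultimately show ?thesis by metis
qed

text \<open>Pulling a cylinder back under the shift only moves its anchor, which \<open>Q\<close>
  ignores; stationarity then follows from uniqueness on cylinders. This resolves the definite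
  descriptions of both operators.\<close>

lemma ex1_shift_inv_measure:
  "\<exists>!\<nu>. \<nu> \<in> shift_inv_measures \<and> (\<forall>i b. b \<noteq> [] \<longrightarrow> measure \<nu> (cylinder i b) = Q b)"
proof -
  obtain \<nu> where \<nu>: "prob_space \<nu>" "sets \<nu> = sets cylinder_algebra"
    and "\<And>A. A \<in> window_sets \<Longrightarrow> measure \<nu> A = premeasure A"
    using extension_exists by blast
  then have cyl: "measure \<nu> (cylinder i b) = Q b" for i b by (rule extension_cylinder)
  have meas: "shift \<in> \<nu> \<rightarrow>\<^sub>M \<nu>"
    using measurable_shift measurable_cong_sets[OF \<nu>(2) \<nu>(2)] by blast
  have space: "space \<nu> = UNIV" using sets_eq_imp_space_eq[OF \<nu>(2)] by simp
  have "distr \<nu> \<nu> shift = \<nu>"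
  proof (rule cylinder_measure_eqI)
    show "prob_space (distr \<nu> \<nu> shift)" by (rule prob_space.prob_space_distr[OF \<nu>(1) meas])
    show "measure (distr \<nu> \<nu> shift) (cylinder i b) = measure \<nu> (cylinder i b)" for i b
      using measure_distr[OF meas, of "cylinder i b"] \<nu>(2) space
      by (simp add: shift_vimage_cylinder cyl)
  qed (use \<nu> in auto)
  then have "\<nu> \<in> shift_inv_measures" using \<nu> by (simp add: shift_inv_measures_def)
  then show ?thesis
    using cyl by (intro ex1I[of _ \<nu>])
      (auto intro!: cylinder_measure_eqI simp: shift_inv_measuresD)
qed

end

lemma consistent_blocks_measure:
  assumes "\<mu> \<in> shift_inv_measures"
  shows "consistent_blocks (\<lambda>b. measure \<mu> (cylinder 0 b))"
proof
  note \<mu> = shift_inv_measuresD[OF assms]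
  show "measure \<mu> (cylinder 0 []) = 1"
    using prob_space.prob_space[OF \<mu>(1)] \<mu>(4) by simp
  fix b
  show "measure \<mu> (cylinder 0 (b @ [False])) + measure \<mu> (cylinder 0 (b @ [True])) =
      measure \<mu> (cylinder 0 b)"
    by (rule measure_cylinder_append[OF \<mu>(1,2), symmetric])
  show "measure \<mu> (cylinder 0 (False # b)) + measure \<mu> (cylinder 0 (True # b)) =
      measure \<mu> (cylinder 0 b)"
    \<comment> \<open>The split puts the new letter at position -1; shift invariance brings the
      anchor back to 0.\<close>
    using measure_cylinder_Cons[OF \<mu>(1,2), of 0 b]
    by (simp add: measure_cylinder_shift_inv[OF assms, of "- 1"])
qed simp

section \<open>Minimal entropy approximation\<close>

text \<open>The four values form a 2x2 table with first row sum \<alpha> and column sums \<beta>,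
  \<delta>. Its entries are nonnegative iff max 0 (\<alpha> - \<delta>) \<le> \<open>Upsilon\<close>
  \<le> min \<alpha> \<beta>. \<open>Upsilon\<close> is always one of these endpoints, and \<alpha>
  \<le> \<beta> + \<delta> helps make the interval nonempty.\<close>

lemma Upsilon_ext_nonneg:
  assumes "0 \<le> \<alpha>" "0 \<le> \<beta>" "0 \<le> \<delta>" "\<alpha> \<le> \<beta> + \<delta>"
  shows "0 \<le> Upsilon_ext x y \<alpha> \<beta> \<delta>"
  using assms by (cases x; cases y) (auto simp: Upsilon_def)

lemma min_entropy_prob_short: "length a \<le> k \<Longrightarrow> min_entropy_prob k P a = P a"
  by (subst min_entropy_prob.simps) simp

lemma min_entropy_prob_long:
  assumes "length c + 2 > k"
  shows "min_entropy_prob k P (x # c @ [y]) =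
    Upsilon_ext x y (min_entropy_prob k P (False # c)) (min_entropy_prob k P (c @ [False]))
      (min_entropy_prob k P (c @ [True]))"
  using assms by (subst min_entropy_prob.simps) simp

text \<open>Nonnegativity and consistency go through one induction, because nonnegativity of a new
  block uses both consistency identities for its interior.\<close>

lemma (in consistent_blocks) min_entropy_prob_consistent_upto:
  fixes k
  defines "R \<equiv> min_entropy_prob k Q"
  shows "(\<forall>b. length b \<le> n \<longrightarrow> 0 \<le> R b) \<and>
    (\<forall>b. length b < n \<longrightarrow> R (b @ [False]) + R (b @ [True]) = R b \<and>
                           R (False # b) + R (True # b) = R b)"
proof (induction n)
  case 0
  then show ?case by (simp add: R_def min_entropy_prob_short nonneg)
next
  case (Suc n)
  show ?case
  \<comment> \<open>Here all blocks involved still carry their original probabilities. The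
    alternative n = 0 matters for k = 0, where the guard \<open>length a < 2\<close>
    applies.\<close>
  proof (cases "Suc n \<le> k \<or> n = 0")
    case True
    then have "R b = Q b" if "length b \<le> Suc n" for b
      using that unfolding R_def by (subst min_entropy_prob.simps) auto
    then show ?thesis
      using nonneg append Cons by simp
  next
    case False
    have nn: "0 \<le> R b" if "length b \<le> n" for b
      using Suc.IH that by blast
    have app: "R (b @ [False]) + R (b @ [True]) = R b"
      and con: "R (False # b) + R (True # b) = R b" if "length b < n" for b
      using Suc.IH that by blast+
    have long: "R (x # c @ [y]) = Upsilon_ext x y (R (False # c)) (R (c @ [False])) (R (c @ [True]))"
      if "length c + 1 = n" for x y c
      using that False unfolding R_def by (intro min_entropy_prob_long) auto
    have nn': "0 \<le> R b" if b: "length b = Suc n" for b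
    proof -
      obtain x b' where "b = x # b'" "length b' = n" using b by (cases b) auto
      then obtain c y where c: "b = x # c @ [y]" "length c + 1 = n"
        using False by (cases b' rule: rev_cases) auto
      \<comment> \<open>The condition \<alpha> \<le> \<beta> + \<delta>: both right-hand terms sum
        to R c = R (0c) + R (1c).\<close>
      have "R (False # c) \<le> R (c @ [False]) + R (c @ [True])"
        using app[of c] con[of c] nn[of "True # c"] c by auto
      then show ?thesis unfolding c(1) long[OF c(2)]
        using c by (intro Upsilon_ext_nonneg nn) auto
    qed
    \<comment> \<open>Row sums of the table: row 0 gives \<alpha> at once, row 1 gives \<beta> +
      \<delta> - \<alpha>, which the identities for c turn into R (1c).\<close>
    have app': "R (b @ [False]) + R (b @ [True]) = R b" if b: "length b = n" for b
    proof -
      obtain x c where c: "b = x # c" "length c + 1 = n" using b False by (cases b) auto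
      show ?thesis using long[OF c(2), of x] app[of c] con[of c] c by (cases x) auto
    qed
    \<comment> \<open>Column sums of the table, equal to \<beta> and \<delta> by
      construction.\<close>
    have con': "R (False # b) + R (True # b) = R b" if b: "length b = n" for b
    proof -
      obtain y c where c: "b = c @ [y]" "length c + 1 = n"
        using b False by (cases b rule: rev_cases) auto
      show ?thesis using long[OF c(2), of _ y] c by (cases y) auto
    qed
    show ?thesis
      using nn nn' app app' con con' by (auto simp: le_Suc_eq less_Suc_eq)
  qed
qed

lemma (in consistent_blocks) consistent_blocks_min_entropy_prob:
  "consistent_blocks (min_entropy_prob k Q)"
proof
  show "min_entropy_prob k Q [] = 1" by (simp add: min_entropy_prob_short Nil)
  fix b :: block
  note * = min_entropy_prob_consistent_upto[of "Suc (length b)" k]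
  show "0 \<le> min_entropy_prob k Q b"
    "min_entropy_prob k Q (b @ [False]) + min_entropy_prob k Q (b @ [True]) = min_entropy_prob k Q b"
    "min_entropy_prob k Q (False # b) + min_entropy_prob k Q (True # b) = min_entropy_prob k Q b"
    using * by (auto simp: less_Suc_eq_le)
qed

lemma entropy_min_operator:
  assumes "\<mu> \<in> shift_inv_measures"
  shows entropy_min_operator_shift_inv: "entropy_min_operator k \<mu> \<in> shift_inv_measures"
    and measure_entropy_min_operator: "b \<noteq> [] \<Longrightarrow> length b \<le> k \<Longrightarrow>
      measure (entropy_min_operator k \<mu>) (cylinder i b) = measure \<mu> (cylinder i b)"
proof -
  interpret consistent_blocks "\<lambda>b. measure \<mu> (cylinder 0 b)"
    by (rule consistent_blocks_measure[OF assms])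
  interpret M: consistent_blocks "min_entropy_prob k (\<lambda>b. measure \<mu> (cylinder 0 b))"
    by (rule consistent_blocks_min_entropy_prob)
  note * = theI'[OF M.ex1_shift_inv_measure, folded entropy_min_operator_def]
  show "entropy_min_operator k \<mu> \<in> shift_inv_measures" using * by blast
  show "measure (entropy_min_operator k \<mu>) (cylinder i b) = measure \<mu> (cylinder i b)"
    if "b \<noteq> []" "length b \<le> k"
    using * that by (simp add: min_entropy_prob_short measure_cylinder_shift_inv[OF assms, of i])
qed

section \<open>Cellular automata\<close>

lemma sum_blocks_Cons:
  fixes g :: "block \<Rightarrow> real"
  shows "(\<Sum>a | length a = Suc m. g a) = (\<Sum>a | length a = m. g (False # a) + g (True # a))"
proof -
  have "{a. length a = Suc m} = (\<lambda>a. False # a) ` {a. length a = m} \<union> (\<lambda>a. True # a) ` {a. length a = m}"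
    by (force simp: length_Suc_conv)
  then have "(\<Sum>a | length a = Suc m. g a) =
      sum g ((\<lambda>a. False # a) ` {a. length a = m}) + sum g ((\<lambda>a. True # a) ` {a. length a = m})"
    by (simp only:) (rule sum.union_disjoint, auto simp: finite_blocks)
  then show ?thesis by (simp add: sum.reindex sum.distrib)
qed

lemma sum_blocks_append:
  fixes g :: "block \<Rightarrow> real"
  shows "(\<Sum>a | length a = Suc m. g a) = (\<Sum>a | length a = m. g (a @ [False]) + g (a @ [True]))"
proof -
  \<comment> \<open>Reversing words exchanges splitting off the last letter with splitting off the
    first.\<close>
  have "(\<Sum>a | length a = Suc m. g a) = (\<Sum>a | length a = Suc m. g (rev a))"
    by (rule sum.reindex_bij_witness[where i = rev and j = rev]) auto
  also have "\<dots> = (\<Sum>a | length a = m. g (rev a @ [False]) + g (rev a @ [True]))"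
    by (simp add: sum_blocks_Cons)
  also have "\<dots> = (\<Sum>a | length a = m. g (a @ [False]) + g (a @ [True]))"
    by (rule sum.reindex_bij_witness[where i = rev and j = rev]) auto
  finally show ?thesis .
qed

lemma block_transition_Nil [simp]: "block_transition r w [] a = 1"
  by (simp add: block_transition_def)

lemma block_transition_Cons:
  "block_transition r w (c # b) (d # a) =
    w c (take (2 * r + 1) (d # a)) * block_transition r w b a"
  unfolding block_transition_def by (simp add: prod.lessThan_Suc_shift del: prod.lessThan_Suc)

text \<open>The length hypothesis aligns neighbourhoods: those of the letters of b lie inside a, and
  that of c is the last 2r+1 letters of \<open>a @ [d]\<close>.\<close>

lemma block_transition_append:
  assumes "length a = length b + 2 * r"
  shows "block_transition r w (b @ [c]) (a @ [d]) =
    block_transition r w b a * w c (drop (length b) (a @ [d]))"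
proof -
  have "(\<Prod>j<length b. w ((b @ [c]) ! j) (take (2 * r + 1) (drop j (a @ [d])))) =
      block_transition r w b a"
    unfolding block_transition_def
    by (rule prod.cong) (use assms in \<open>auto simp: nth_append\<close>)
  then show ?thesis
    using assms by (simp add: block_transition_def)
qed

lemma local_transitionD:
  assumes "local_transition r w" "length b = 2 * r + 1"
  shows "0 \<le> w a b" "w False b + w True b = 1"
  using assms by (auto simp: local_transition_def UNIV_bool add.commute)

lemma block_transition_nonneg:
  assumes "local_transition r w" "length a = length b + 2 * r"
  shows "0 \<le> block_transition r w b a"
  unfolding block_transition_def
  by (intro prod_nonneg ballI local_transitionD(1)[OF assms(1)]) (use assms(2) in auto)

lemma (in consistent_blocks) sum_blocks: "(\<Sum>a | length a = m. Q a) = 1"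
  by (induction m) (simp_all add: sum_blocks_append append Nil)

text \<open>Intended reading: q, q' are the masses of the two input extensions, x, x' their weights
  towards one new output letter, and y, y' those towards the other.\<close>

lemma sum_products_eq:
  fixes x :: real
  assumes "x + y = t" "x' + y' = t" "q + q' = u"
  shows "x * q + x' * q' + (y * q + y' * q') = t * u"
proof -
  have "x * q + x' * q' + (y * q + y' * q') = (x + y) * q + (x' + y') * q'"
    by (simp add: algebra_simps)
  then show ?thesis
    using assms by (simp add: distrib_left[symmetric])
qed

text \<open>Sum the new output letter first: its two local probabilities add to 1, which leaves a
  weight independent of the new input letter. Consistency of \<open>Q\<close> then sums out that
  letter. The same scheme works at both ends.\<close>

lemma (in consistent_blocks) consistent_blocks_cellular_automaton:
  assumes w: "local_transition r w"
  shows "consistent_blocks (\<lambda>b. \<Sum>a | length a = length b + 2 * r. block_transition r w b a * Q a)"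
proof
  fix b :: block
  show "0 \<le> (\<Sum>a | length a = length b + 2 * r. block_transition r w b a * Q a)"
    using block_transition_nonneg[OF w] nonneg by (intro sum_nonneg mult_nonneg_nonneg) auto
  show "(\<Sum>a | length a = length [] + 2 * r. block_transition r w [] a * Q a) = 1"
    by (simp add: sum_blocks)
  have "block_transition r w (b @ [False]) (a @ [d]) + block_transition r w (b @ [True]) (a @ [d]) =
      block_transition r w b a" if "length a = length b + 2 * r" for a d
    using that local_transitionD(2)[OF w, of "drop (length b) (a @ [d])"]
    by (simp add: block_transition_append distrib_left[symmetric] del: drop_append)
  note split = this
  have "(\<Sum>a | length a = length b + 2 * r.
        block_transition r w (b @ [False]) (a @ [False]) * Q (a @ [False])
          + block_transition r w (b @ [False]) (a @ [True]) * Q (a @ [True])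
        + (block_transition r w (b @ [True]) (a @ [False]) * Q (a @ [False])
          + block_transition r w (b @ [True]) (a @ [True]) * Q (a @ [True]))) =
      (\<Sum>a | length a = length b + 2 * r. block_transition r w b a * Q a)"
  proof (rule sum.cong[OF refl])
    fix a :: block assume "a \<in> {a. length a = length b + 2 * r}"
    then have a: "length a = length b + 2 * r" by simp
    show "block_transition r w (b @ [False]) (a @ [False]) * Q (a @ [False])
          + block_transition r w (b @ [False]) (a @ [True]) * Q (a @ [True])
        + (block_transition r w (b @ [True]) (a @ [False]) * Q (a @ [False])
          + block_transition r w (b @ [True]) (a @ [True]) * Q (a @ [True])) =
        block_transition r w b a * Q a"
      by (rule sum_products_eq[OF split[OF a] split[OF a] append])
  qed
  then show "(\<Sum>a | length a = length (b @ [False]) + 2 * r. block_transition r w (b @ [False]) a * Q a) +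
      (\<Sum>a | length a = length (b @ [True]) + 2 * r. block_transition r w (b @ [True]) a * Q a) =
      (\<Sum>a | length a = length b + 2 * r. block_transition r w b a * Q a)"
    by (simp add: sum_blocks_append sum.distrib)
  have "block_transition r w (False # b) (d # a) + block_transition r w (True # b) (d # a) =
      block_transition r w b a" if "length a = length b + 2 * r" for a d
    using that local_transitionD(2)[OF w, of "take (2 * r + 1) (d # a)"]
    by (simp add: block_transition_Cons distrib_right[symmetric] del: take_Suc_Cons)
  note split = this
  have "(\<Sum>a | length a = length b + 2 * r.
        block_transition r w (False # b) (False # a) * Q (False # a)
          + block_transition r w (False # b) (True # a) * Q (True # a)
        + (block_transition r w (True # b) (False # a) * Q (False # a)
          + block_transition r w (True # b) (True # a) * Q (True # a))) =
      (\<Sum>a | length a = length b + 2 * r. block_transition r w b a * Q a)"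
  proof (rule sum.cong[OF refl])
    fix a :: block assume "a \<in> {a. length a = length b + 2 * r}"
    then have a: "length a = length b + 2 * r" by simp
    show "block_transition r w (False # b) (False # a) * Q (False # a)
          + block_transition r w (False # b) (True # a) * Q (True # a)
        + (block_transition r w (True # b) (False # a) * Q (False # a)
          + block_transition r w (True # b) (True # a) * Q (True # a)) =
        block_transition r w b a * Q a"
      by (rule sum_products_eq[OF split[OF a] split[OF a] Cons])
  qed
  then show "(\<Sum>a | length a = length (False # b) + 2 * r. block_transition r w (False # b) a * Q a) +
      (\<Sum>a | length a = length (True # b) + 2 * r. block_transition r w (True # b) a * Q a) =
      (\<Sum>a | length a = length b + 2 * r. block_transition r w b a * Q a)"
    by (simp add: sum_blocks_Cons sum.distrib)
qed

lemma cellular_automaton: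
  assumes w: "local_transition r w" and \<mu>: "\<mu> \<in> shift_inv_measures"
  shows cellular_automaton_shift_inv: "cellular_automaton r w \<mu> \<in> shift_inv_measures"
    and measure_cellular_automaton: "b \<noteq> [] \<Longrightarrow>
      measure (cellular_automaton r w \<mu>) (cylinder i b) =
        (\<Sum>a | length a = length b + 2 * r.
           block_transition r w b a * measure \<mu> (cylinder (i - int r) a))"
proof -
  interpret consistent_blocks "\<lambda>b. measure \<mu> (cylinder 0 b)"
    by (rule consistent_blocks_measure[OF \<mu>])
  interpret M: consistent_blocks "\<lambda>b. \<Sum>a | length a = length b + 2 * r.
      block_transition r w b a * measure \<mu> (cylinder 0 a)"
    by (rule consistent_blocks_cellular_automaton[OF w])
  \<comment> \<open>Shift invariance removes the anchor i - r, so that the image probabilities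
    become a block function without anchor.\<close>
  have "measure \<mu> (cylinder (i - int r) a) = measure \<mu> (cylinder 0 a)" for i a
    by (rule measure_cylinder_shift_inv[OF \<mu>])
  then have "\<exists>!\<nu>. \<nu> \<in> shift_inv_measures \<and> (\<forall>i b. b \<noteq> [] \<longrightarrow> measure \<nu> (cylinder i b) =
      (\<Sum>a | length a = length b + 2 * r.
         block_transition r w b a * measure \<mu> (cylinder (i - int r) a)))"
    using M.ex1_shift_inv_measure by simp
  note * = theI'[OF this, folded cellular_automaton_def]
  show "cellular_automaton r w \<mu> \<in> shift_inv_measures" using * by blast
  show "b \<noteq> [] \<Longrightarrow> measure (cellular_automaton r w \<mu>) (cylinder i b) =
        (\<Sum>a | length a = length b + 2 * r.
           block_transition r w b a * measure \<mu> (cylinder (i - int r) a))"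
    using * by blast
qed

lemma cellular_automaton_funpow_shift_inv:
  assumes "local_transition r w" "\<mu> \<in> shift_inv_measures"
  shows "(cellular_automaton r w ^^ n) \<mu> \<in> shift_inv_measures"
  by (induction n) (use assms in \<open>auto intro: cellular_automaton_shift_inv\<close>)

lemma approximation_shift_inv:
  assumes "local_transition r w" "\<mu> \<in> shift_inv_measures"
  shows "((entropy_min_operator k \<circ> cellular_automaton r w \<circ> entropy_min_operator k) ^^ n) \<mu>
    \<in> shift_inv_measures"
  by (induction n)
     (use assms in \<open>auto intro: cellular_automaton_shift_inv entropy_min_operator_shift_inv\<close>)

text \<open>A length budget: each automaton step spends 2r letters, while the entropy operator
  spends none on blocks of length at most k. Block and anchor vary in the induction, as the
  hypothesis is needed for wider blocks at other anchors.\<close>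

lemma measure_approximation_cylinder:
  assumes w: "local_transition r w" and \<mu>: "\<mu> \<in> shift_inv_measures"
    and "b \<noteq> []" "length b + 2 * r * n \<le> k"
  shows "measure (((entropy_min_operator k \<circ> cellular_automaton r w \<circ> entropy_min_operator k) ^^ n) \<mu>)
      (cylinder i b) = measure ((cellular_automaton r w ^^ n) \<mu>) (cylinder i b)"
  using assms(3,4)
proof (induction n arbitrary: i b)
  case (Suc n)
  let ?\<nu> = "((entropy_min_operator k \<circ> cellular_automaton r w \<circ> entropy_min_operator k) ^^ n) \<mu>"
  let ?\<rho> = "(cellular_automaton r w ^^ n) \<mu>"
  have \<nu>: "?\<nu> \<in> shift_inv_measures" by (rule approximation_shift_inv[OF w \<mu>])
  note \<Psi> = entropy_min_operator_shift_inv[OF \<nu>, of k]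
  have "measure (entropy_min_operator k ?\<nu>) (cylinder j a) = measure ?\<rho> (cylinder j a)"
    if "length a = length b + 2 * r" for j a
  proof -
    have a: "a \<noteq> []" "length a + 2 * r * n \<le> k" using Suc.prems that by (auto simp: algebra_simps)
    then have "length a \<le> k" by simp
    from measure_entropy_min_operator[OF \<nu> a(1) this] Suc.IH[OF a] show ?thesis by (rule trans)
  qed
  then have "measure (cellular_automaton r w (entropy_min_operator k ?\<nu>)) (cylinder i b) =
      measure (cellular_automaton r w ?\<rho>) (cylinder i b)"
    using Suc.prems(1)
    by (simp add: measure_cellular_automaton[OF w \<Psi>]
          measure_cellular_automaton[OF w cellular_automaton_funpow_shift_inv[OF w \<mu>]])
  moreover have "measure (entropy_min_operator k (cellular_automaton r w (entropy_min_operator k ?\<nu>)))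
      (cylinder i b) = measure (cellular_automaton r w (entropy_min_operator k ?\<nu>)) (cylinder i b)"
    using Suc.prems
    by (intro measure_entropy_min_operator[OF cellular_automaton_shift_inv[OF w \<Psi>]]) auto
  ultimately show ?case by (simp only: funpow.simps comp_def)
qed simp

section \<open>Weak convergence\<close>

lemma measurable_window:
  "sets M = sets cylinder_algebra \<Longrightarrow> window N \<in> M \<rightarrow>\<^sub>M count_space UNIV"
  using sets_eq_imp_space_eq[of M cylinder_algebra]
  by (auto simp: measurable_def window_vimage_sets)

lemma integral_window:
  fixes g :: "block \<Rightarrow> real"
  assumes M: "prob_space M" "sets M = sets cylinder_algebra"
  shows "(\<integral>x. g (window N x) \<partial>M) =
    (\<Sum>b | length b = 2 * N + 1. g b * measure M (cylinder (- int N) b))"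
proof -
  interpret prob_space M by fact
  \<comment> \<open>Exactly one of these cylinders contains x, so a function of the window is a
    finite combination of indicators.\<close>
  have "g (window N x) = (\<Sum>b | length b = 2 * N + 1. g b * indicator (cylinder (- int N) b) x)" for x
  proof -
    have "(\<Sum>b | length b = 2 * N + 1. g b * indicator (cylinder (- int N) b) x) =
        (\<Sum>b | length b = 2 * N + 1. if window N x = b then g b else 0)"
      by (rule sum.cong) (auto simp: window_vimage_singleton[symmetric])
    then show ?thesis by (simp add: finite_blocks)
  qed
  then show ?thesis
    using M(2) by (simp add: cylinder_sets sets_eq_imp_space_eq[OF M(2)] integrable_real_mult_indicator
        emeasure_eq_measure less_top)
qed

text \<open>f is the pointwise limit of functions that factor through a window, and these are
  measurable because words carry the discrete sigma-algebra.\<close>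

lemma measurable_continuous_config:
  fixes f :: "config \<Rightarrow> real"
  assumes f: "continuous_on UNIV f" and M: "sets M = sets cylinder_algebra"
  shows "f \<in> borel_measurable M"
proof (rule borel_measurable_LIMSEQ_real)
  show "(\<lambda>N. f (unwindow N (window N x))) \<longlonglongrightarrow> f x" for x
  proof (rule LIMSEQ_I)
    fix e :: real assume "e > 0"
    from continuous_uniform_window[OF f this]
    obtain N where N: "\<And>x y. window N x = window N y \<Longrightarrow> \<bar>f x - f y\<bar> < e" by blast
    have "norm (f (unwindow n (window n x)) - f x) < e" if "n \<ge> N" for n
    proof -
      have "window n (unwindow n (window n x)) = window n x" by (simp add: window_unwindow)
      then have "window N (unwindow n (window n x)) = window N x"
        using that by (rule window_eq_mono)
      then show ?thesis using N by simp
    qed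
    then show "\<exists>no. \<forall>n\<ge>no. norm (f (unwindow n (window n x)) - f x) < e" by blast
  qed
  show "(\<lambda>x. f (unwindow N (window N x))) \<in> borel_measurable M" for N
    by (rule measurable_compose[OF measurable_window[OF M]]) simp
qed

text \<open>Replacing x by \<open>unwindow N (window N x)\<close> keeps its window and so moves f by
  less than e everywhere; total mass 1 carries the bound over to the integrals.\<close>

lemma integral_window_approx:
  fixes f :: "config \<Rightarrow> real"
  assumes M: "prob_space M" "sets M = sets cylinder_algebra"
    and f: "continuous_on UNIV f" "bounded (range f)"
    and N: "\<And>x y. window N x = window N y \<Longrightarrow> \<bar>f x - f y\<bar> < e"
  shows "\<bar>(\<integral>x. f x \<partial>M) - (\<integral>x. f (unwindow N (window N x)) \<partial>M)\<bar> \<le> e"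
proof -
  interpret prob_space M by fact
  obtain B where B: "\<And>x. \<bar>f x\<bar> \<le> B"
    using f(2) by (auto simp: bounded_iff)
  have int: "integrable M f"
    by (rule integrable_const_bound[where B = B])
       (use B measurable_continuous_config[OF f(1) M(2)] in auto)
  have intw: "integrable M (\<lambda>x. f (unwindow N (window N x)))"
    by (rule integrable_const_bound[where B = B])
       (use B measurable_compose[OF measurable_window[OF M(2)], of "\<lambda>b. f (unwindow N b)" borel] in auto)
  have "\<bar>\<integral>x. f x - f (unwindow N (window N x)) \<partial>M\<bar> \<le> (\<integral>x. \<bar>f x - f (unwindow N (window N x))\<bar> \<partial>M)"
    by (rule integral_abs_bound)
  also have "\<dots> \<le> (\<integral>x. e \<partial>M)"
    by (rule integral_mono)
       (use int intw N in \<open>auto intro!: less_imp_le simp: window_unwindow\<close>)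
  finally show ?thesis using int intw by (simp add: prob_space)
qed

lemma weakly_convergesI_cylinders:
  fixes M :: "nat \<Rightarrow> config measure"
  assumes M: "\<And>k. prob_space (M k)" "\<And>k. sets (M k) = sets cylinder_algebra"
    and L: "prob_space L" "sets L = sets cylinder_algebra"
    and ev: "\<And>i b. b \<noteq> [] \<Longrightarrow>
      (\<lambda>k. measure (M k) (cylinder i b)) \<longlonglongrightarrow> measure L (cylinder i b)"
  shows "weakly_converges M L"
  unfolding weakly_converges_def
proof (intro allI impI LIMSEQ_I, elim conjE)
  fix f :: "config \<Rightarrow> real" and e :: real
  assume f: "continuous_on UNIV f" "bounded (range f)" and "e > 0"
  \<comment> \<open>One third for each of the two replacements of f by its windowed version, and one
    for the convergence of the windowed integrals, which are finite sums over cylinders.\<close>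
  then have "e / 3 > 0" by simp
  from continuous_uniform_window[OF f(1) this]
  obtain N where N: "\<And>x y. window N x = window N y \<Longrightarrow> \<bar>f x - f y\<bar> < e / 3" by blast
  let ?g = "\<lambda>x. f (unwindow N (window N x))"
  have "(\<lambda>k. \<integral>x. ?g x \<partial>M k) \<longlonglongrightarrow> (\<integral>x. ?g x \<partial>L)"
    unfolding integral_window[OF M, where g = "\<lambda>b. f (unwindow N b)"]
      integral_window[OF L, where g = "\<lambda>b. f (unwindow N b)"]
    by (intro tendsto_sum tendsto_mult tendsto_const ev) auto
  from LIMSEQ_D[OF this \<open>e / 3 > 0\<close>]
  obtain K where K: "\<And>k. k \<ge> K \<Longrightarrow> \<bar>(\<integral>x. ?g x \<partial>M k) - (\<integral>x. ?g x \<partial>L)\<bar> < e / 3" by auto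
  have "norm ((\<integral>x. f x \<partial>M k) - (\<integral>x. f x \<partial>L)) < e" if "k \<ge> K" for k
    using K[OF that] integral_window_approx[OF M[of k] f, of N "e / 3", OF N]
      integral_window_approx[OF L f, of N "e / 3", OF N]
    unfolding real_norm_def by linarith
  then show "\<exists>no. \<forall>k\<ge>no. norm ((\<integral>x. f x \<partial>M k) - (\<integral>x. f x \<partial>L)) < e" by blast
qed


theorem theorem4p1:
  fixes r n :: nat
    and w :: "bool \<Rightarrow> block \<Rightarrow> real"
    and \<mu> :: "config measure"
  assumes "local_transition r w"
    and "\<mu> \<in> shift_inv_measures"
    and "n > 0"
  shows "weakly_converges
           (\<lambda>k. ((entropy_min_operator k \<circ> cellular_automaton r w \<circ> entropy_min_operator k) ^^ n) \<mu>)
           ((cellular_automaton r w ^^ n) \<mu>)"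
proof (rule weakly_convergesI_cylinders)
  fix i :: int and b :: block assume b: "b \<noteq> []"
  \<comment> \<open>The sequence is constant once k reaches |b| + 2rn.\<close>
  have "\<forall>\<^sub>F k in sequentially.
      measure (((entropy_min_operator k \<circ> cellular_automaton r w \<circ> entropy_min_operator k) ^^ n) \<mu>)
        (cylinder i b) = measure ((cellular_automaton r w ^^ n) \<mu>) (cylinder i b)"
    unfolding eventually_sequentially
    using measure_approximation_cylinder[OF assms(1,2) b] by blast
  then show "(\<lambda>k. measure (((entropy_min_operator k \<circ> cellular_automaton r w \<circ>
        entropy_min_operator k) ^^ n) \<mu>) (cylinder i b))
      \<longlonglongrightarrow> measure ((cellular_automaton r w ^^ n) \<mu>) (cylinder i b)"
    by (rule tendsto_eventually)
qed (rule shift_inv_measuresD, rule approximation_shift_inv cellular_automaton_funpow_shift_inv,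
     (rule assms)+)+

end
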